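(* Let $f\colon \mathbb{R}^{d_x}\times\mathbb{R}^{d_y}\to\mathbb{R}$ be a differentiable convex function that is $(L_x,L_y)$-smooth and $(\mu_x,\mu_y)$-strongly convex with $L_x,L_y,\mu_x,\mu_y>0$, and let $(x^*,y^* )$ be the minimizer of $f$. Set $$\alpha=\sqrt{\frac{\mu_x}{L_x}},\qquad \eta_x=\frac{1}{\sqrt{\mu_xL_x}},\qquad \eta_y=\frac{1}{\mu_y}\sqrt{\frac{\mu_x}{L_x}},$$ where $\alpha\in(0,1)$. Let $(x^k,y^k,\overline{x}^k,\overline{y}^k)_{k\ge 0}$ be any iterates generated by the Block Accelerated Method (BAM) with these parameters. Define $$\Psi^k=(1+\alpha)\left(\eta_x^{-1}\|x^k-x^*\|^2+\eta_y^{-1}\|y^k-y^*\|^2\right)+\frac{2}{\alpha}\left(f(\overline{x}^k,\overline{y}^k)-f(x^*,y^* )\right).$$ Then for every iteration $k\ge 0$, $$\Psi^{k+1}\le(1+\alpha)^{-1}\Psi^k.$$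
   Context: Norms and inner products are Euclidean. $\nabla_x f$ and $\nabla_y f$ denote the partial gradients of $f$ with respect to the blocks $x\in\mathbb{R}^{d_x}$ and $y\in\mathbb{R}^{d_y}$. $f$ is $(L_x,L_y)$-smooth if for all $x_1,x_2\in\mathbb{R}^{d_x}$, $y_1,y_2\in\mathbb{R}^{d_y}$: $$f(x_2,y_2)\le f(x_1,y_1)+\langle\nabla_x f(x_1,y_1),x_2-x_1\rangle+\langle\nabla_y f(x_1,y_1),y_2-y_1\rangle+\frac{L_x}{2}\|x_2-x_1\|^2+\frac{L_y}{2}\|y_2-y_1\|^2.$$ $f$ is $(\mu_x,\mu_y)$-strongly convex if for all $x_1,x_2\in\mathbb{R}^{d_x}$, $y_1,y_2\in\mathbb{R}^{d_y}$: $$f(x_2,y_2)\ge f(x_1,y_1)+\langle\nabla_x f(x_1,y_1),x_2-x_1\rangle+\langle\nabla_y f(x_1,y_1),y_2-y_1\rangle+\frac{\mu_x}{2}\|x_2-x_1\|^2+\frac{\mu_y}{2}\|y_2-y_1\|^2.$$ Block Accelerated Method (BAM), with parameters $\eta_x,\eta_y>0$, $\alpha\in(0,1)$ and input $x^0=\overline{x}^0\in\mathbb{R}^{d_x}$, $y^0=\overline{y}^0\in\mathbb{R}^{d_y}$. For $k=0,1,2,\dots$: 1. $\underline{x}^k=\alpha x^k+(1-\alpha)\overline{x}^k$ and $\underline{y}^k=\alpha y^k+(1-\alpha)\overline{y}^k$. 2. Find any $\overline{y}^{k+1}\in\mathbb{R}^{d_y}$ such that $$\left\|\nabla_y f(\underline{x}^k,\overline{y}^{k+1})+(\eta_y\alpha)^{-1}(\overline{y}^{k+1}-\underline{y}^k)\right\|\le(\eta_y\alpha)^{-1}\|\overline{y}^{k+1}-\underline{y}^k\|.$$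 3. $\overline{x}^{k+1}=\underline{x}^k-\eta_x\alpha\nabla_x f(\underline{x}^k,\overline{y}^{k+1})$. 4. $x^{k+1}$ is defined (implicitly) by $x^{k+1}=x^k+\alpha(\underline{x}^k-x^{k+1})-\eta_x\nabla_x f(\underline{x}^k,\overline{y}^{k+1})$. 5. $y^{k+1}$ is defined (implicitly) by $y^{k+1}=y^k+\alpha(\overline{y}^{k+1}-y^{k+1})-\eta_y\nabla_y f(\underline{x}^k,\overline{y}^{k+1})$. *)

theory Defs
  imports "HOL-Analysis.Analysis"
begin

text \<open>The norm and inner product of the product type are the Euclidean ones, so a function
  on \<open>real ^ 'm \<times> real ^ 'n\<close> is a function on the Euclidean space with blocks \<open>x\<close> and \<open>y\<close>.\<close>

text \<open>\<open>GDERIV\<close> is the library's relational gradient.  The value of \<open>gradient\<close> is meaningful only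
  where the function is differentiable.\<close>

definition gradient :: "('a::real_inner \<Rightarrow> real) \<Rightarrow> 'a \<Rightarrow> 'a" where
  "gradient g x = (THE D. GDERIV g x :> D)"

definition grad_x :: "('a::real_inner \<times> 'b::real_inner \<Rightarrow> real) \<Rightarrow> 'a \<Rightarrow> 'b \<Rightarrow> 'a" where
  "grad_x f x y = gradient (\<lambda>x'. f (x', y)) x"

definition grad_y :: "('a::real_inner \<times> 'b::real_inner \<Rightarrow> real) \<Rightarrow> 'a \<Rightarrow> 'b \<Rightarrow> 'b" where
  "grad_y f x y = gradient (\<lambda>y'. f (x, y')) y"

definition block_smooth ::
    "real \<Rightarrow> real \<Rightarrow> ('a::real_inner \<times> 'b::real_inner \<Rightarrow> real) \<Rightarrow> bool" where
  "block_smooth Lx Ly f \<longleftrightarrow>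
    (\<forall>x1 x2 y1 y2.
      f (x2, y2) \<le> f (x1, y1) + grad_x f x1 y1 \<bullet> (x2 - x1) + grad_y f x1 y1 \<bullet> (y2 - y1)
        + Lx / 2 * (norm (x2 - x1))\<^sup>2 + Ly / 2 * (norm (y2 - y1))\<^sup>2)"

definition block_strongly_convex ::
    "real \<Rightarrow> real \<Rightarrow> ('a::real_inner \<times> 'b::real_inner \<Rightarrow> real) \<Rightarrow> bool" where
  "block_strongly_convex \<mu>x \<mu>y f \<longleftrightarrow>
    (\<forall>x1 x2 y1 y2.
      f (x2, y2) \<ge> f (x1, y1) + grad_x f x1 y1 \<bullet> (x2 - x1) + grad_y f x1 y1 \<bullet> (y2 - y1)
        + \<mu>x / 2 * (norm (x2 - x1))\<^sup>2 + \<mu>y / 2 * (norm (y2 - y1))\<^sup>2)"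

text \<open>One iteration of the Block Accelerated Method, as a relation between the current iterate
  \<open>(x, y, xb, yb)\<close> and the next one \<open>(x', y', xb', yb')\<close>; \<open>xb\<close> and \<open>yb\<close> are the overlined
  variables, \<open>xu\<close> and \<open>yu\<close> the underlined ones.  It is a relation because \<open>yb'\<close> may be any
  point satisfying the inexactness criterion; \<open>x'\<close> and \<open>y'\<close> occur on both sides of their
  defining equations.\<close>

definition bam_step ::
    "('a::real_inner \<times> 'b::real_inner \<Rightarrow> real) \<Rightarrow> real \<Rightarrow> real \<Rightarrow> real
      \<Rightarrow> 'a \<Rightarrow> 'b \<Rightarrow> 'a \<Rightarrow> 'b \<Rightarrow> 'a \<Rightarrow> 'b \<Rightarrow> 'a \<Rightarrow> 'b \<Rightarrow> bool" where
  "bam_step f \<eta>x \<eta>y \<alpha> x y xb yb x' y' xb' yb' \<longleftrightarrow>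
    (let xu = \<alpha> *\<^sub>R x + (1 - \<alpha>) *\<^sub>R xb;
         yu = \<alpha> *\<^sub>R y + (1 - \<alpha>) *\<^sub>R yb
     in norm (grad_y f xu yb' + inverse (\<eta>y * \<alpha>) *\<^sub>R (yb' - yu))
          \<le> inverse (\<eta>y * \<alpha>) * norm (yb' - yu)
      \<and> xb' = xu - (\<eta>x * \<alpha>) *\<^sub>R grad_x f xu yb'
      \<and> x' = x + \<alpha> *\<^sub>R (xu - x') - \<eta>x *\<^sub>R grad_x f xu yb'
      \<and> y' = y + \<alpha> *\<^sub>R (yb' - y') - \<eta>y *\<^sub>R grad_y f xu yb')"

definition bam_iterates ::
    "('a::real_inner \<times> 'b::real_inner \<Rightarrow> real) \<Rightarrow> real \<Rightarrow> real \<Rightarrow> real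
      \<Rightarrow> (nat \<Rightarrow> 'a) \<Rightarrow> (nat \<Rightarrow> 'b) \<Rightarrow> (nat \<Rightarrow> 'a) \<Rightarrow> (nat \<Rightarrow> 'b) \<Rightarrow> bool" where
  "bam_iterates f \<eta>x \<eta>y \<alpha> x y xb yb \<longleftrightarrow>
    x 0 = xb 0 \<and> y 0 = yb 0 \<and>
    (\<forall>k. bam_step f \<eta>x \<eta>y \<alpha> (x k) (y k) (xb k) (yb k)
           (x (Suc k)) (y (Suc k)) (xb (Suc k)) (yb (Suc k)))"

end

theory Submission
  imports Defs
begin

text \<open>Each implicit update is a proximal step, so expanding it around the minimizer bounds the new
  distance by the old one, a strong convexity term, a gradient term \<open>\<eta>\<^sup>2 \<parallel>g\<parallel>\<^sup>2\<close> and
  a linear term.  The gradient term of the block \<open>x\<close> is paid for by the descent of the step from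
  \<open>xu\<close> to \<open>xb'\<close>, that of the block \<open>y\<close> by the inexactness criterion, which says that
  \<open>2 \<langle>g, yb' - yu\<rangle> \<le> - \<eta>y \<alpha> \<parallel>g\<parallel>\<^sup>2\<close>.  The linear terms are bounded by
  strong convexity at \<open>(xu, yb')\<close>, towards the minimizer and towards \<open>(xb, yb)\<close>.  This yields
  the contraction factor \<open>1 - \<alpha> \<le> 1 / (1 + \<alpha>)\<close> for the gap in function values.\<close>

lemma implicit_step_bound:
  fixes x x' v g p :: "'a::real_inner"
  assumes step: "x' = x + \<alpha> *\<^sub>R (v - x') - \<eta> *\<^sub>R g" and "\<alpha> \<ge> 0" and "\<eta> > 0"
  shows "(1 + \<alpha>) * (inverse \<eta> * (norm (x' - p))\<^sup>2)
    \<le> inverse \<eta> * (norm (x - p))\<^sup>2 + \<alpha> / \<eta> * (norm (v - p))\<^sup>2 - 2 * (g \<bullet> (x - p)) + \<eta> * (norm g)\<^sup>2"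
proof -
  \<comment> \<open>Solving the implicit equation for the gradient and pairing with
    \<open>x' - p\<close> leaves two inner products, each expanded by the three-point
    identity.\<close>
  have "\<eta> *\<^sub>R g = (x - x') + \<alpha> *\<^sub>R (v - x')"
    using step by (metis add_diff_cancel_left' add_diff_eq diff_diff_eq2 diff_add_eq)
  then have "\<eta> * (g \<bullet> (x' - p)) = (x - x') \<bullet> (x' - p) + \<alpha> * ((v - x') \<bullet> (x' - p))"
    by (metis inner_add_left inner_scaleR_left)
  moreover have "2 * ((x - x') \<bullet> (x' - p)) = (norm (x - p))\<^sup>2 - (norm (x' - p))\<^sup>2 - (norm (x' - x))\<^sup>2"
    by (simp add: power2_norm_eq_inner inner_diff_left inner_diff_right inner_commute)
  moreover have "2 * ((v - x') \<bullet> (x' - p)) = (norm (v - p))\<^sup>2 - (norm (x' - p))\<^sup>2 - (norm (x' - v))\<^sup>2"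
    by (simp add: power2_norm_eq_inner inner_diff_left inner_diff_right inner_commute)
  ultimately have "2 * (\<eta> * (g \<bullet> (x' - p))) = ((norm (x - p))\<^sup>2 - (norm (x' - p))\<^sup>2 - (norm (x' - x))\<^sup>2)
      + \<alpha> * ((norm (v - p))\<^sup>2 - (norm (x' - p))\<^sup>2 - (norm (x' - v))\<^sup>2)"
    by (simp add: distrib_left mult.left_commute)
  \<comment> \<open>The term with \<open>norm (x' - x)\<close> from the three-point identity moves
    the linear term in \<open>g\<close> from \<open>x'\<close> to \<open>x\<close>, at the cost of
    the squared gradient.\<close>
  moreover have "0 \<le> (norm (x' - x))\<^sup>2 + 2 * \<eta> * (g \<bullet> (x' - x)) + \<eta>\<^sup>2 * (norm g)\<^sup>2"
  proof -
    have "0 \<le> (norm ((x' - x) + \<eta> *\<^sub>R g))\<^sup>2"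
      by simp
    also have "\<dots> = (norm (x' - x))\<^sup>2 + 2 * \<eta> * (g \<bullet> (x' - x)) + \<eta>\<^sup>2 * (norm g)\<^sup>2"
      unfolding power2_norm_eq_inner
      by (simp add: inner_add_left inner_add_right inner_commute power2_eq_square algebra_simps)
    finally show ?thesis .
  qed
  moreover have "\<alpha> * (norm (x' - v))\<^sup>2 \<ge> 0"
    using \<open>\<alpha> \<ge> 0\<close> by simp
  moreover have "g \<bullet> (x' - p) = g \<bullet> (x' - x) + g \<bullet> (x - p)"
    by (simp add: inner_diff_right)
  ultimately have "(1 + \<alpha>) * (norm (x' - p))\<^sup>2
    \<le> (norm (x - p))\<^sup>2 + \<alpha> * (norm (v - p))\<^sup>2 - 2 * \<eta> * (g \<bullet> (x - p)) + \<eta>\<^sup>2 * (norm g)\<^sup>2"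
    by (simp add: algebra_simps)
  then have "inverse \<eta> * ((1 + \<alpha>) * (norm (x' - p))\<^sup>2)
    \<le> inverse \<eta> * ((norm (x - p))\<^sup>2 + \<alpha> * (norm (v - p))\<^sup>2 - 2 * \<eta> * (g \<bullet> (x - p)) + \<eta>\<^sup>2 * (norm g)\<^sup>2)"
    using \<open>\<eta> > 0\<close> by (intro mult_left_mono) auto
  then show ?thesis
    using \<open>\<eta> > 0\<close> by (simp add: field_simps power2_eq_square)
qed

text \<open>The relation \<open>\<eta>x * \<alpha> * Lx = 1\<close> makes the step to
  \<open>xb'\<close> a gradient step of length 1 / \<open>Lx\<close>; the other two match the
  proximal weights to the strong convexity moduli. The factor 1 - \<alpha> stays as it is, since
  weakening it to \<open>inverse (1 + \<alpha>)\<close> takes a nonnegative gap, while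
  \<open>(p, q)\<close> is arbitrary here.\<close>

lemma bam_step_contraction:
  assumes smooth: "block_smooth Lx Ly f"
    and convex: "block_strongly_convex \<mu>x \<mu>y f"
    and step: "bam_step f \<eta>x \<eta>y \<alpha> x y xb yb x' y' xb' yb'"
    and "0 < \<alpha>" "\<alpha> < 1" "0 < \<eta>x" "0 < \<eta>y"
    and params: "\<eta>x * \<alpha> * Lx = 1" "\<alpha> / \<eta>x = \<mu>x" "\<alpha> / \<eta>y = \<mu>y"
  shows "(1 + \<alpha>) * (inverse \<eta>x * (norm (x' - p))\<^sup>2 + inverse \<eta>y * (norm (y' - q))\<^sup>2)
      + 2 / \<alpha> * (f (xb', yb') - f (p, q))
    \<le> inverse \<eta>x * (norm (x - p))\<^sup>2 + inverse \<eta>y * (norm (y - q))\<^sup>2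
      + (1 - \<alpha>) * (2 / \<alpha> * (f (xb, yb) - f (p, q)))"
proof -
  define xu yu where "xu = \<alpha> *\<^sub>R x + (1 - \<alpha>) *\<^sub>R xb" and "yu = \<alpha> *\<^sub>R y + (1 - \<alpha>) *\<^sub>R yb"
  define g h where "g = grad_x f xu yb'" and "h = grad_y f xu yb'"
  have inexact: "norm (h + inverse (\<eta>y * \<alpha>) *\<^sub>R (yb' - yu)) \<le> inverse (\<eta>y * \<alpha>) * norm (yb' - yu)"
    and xb': "xb' = xu - (\<eta>x * \<alpha>) *\<^sub>R g"
    and x': "x' = x + \<alpha> *\<^sub>R (xu - x') - \<eta>x *\<^sub>R g"
    and y': "y' = y + \<alpha> *\<^sub>R (yb' - y') - \<eta>y *\<^sub>R h"
    using step unfolding bam_step_def Let_def xu_def yu_def g_def h_def by blast+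
  have \<mu>: "\<mu>x > 0" "\<mu>y > 0"
    using params \<open>0 < \<alpha>\<close> \<open>0 < \<eta>x\<close> \<open>0 < \<eta>y\<close> by auto

  have bound_x: "(1 + \<alpha>) * (inverse \<eta>x * (norm (x' - p))\<^sup>2)
    \<le> inverse \<eta>x * (norm (x - p))\<^sup>2 + \<mu>x * (norm (xu - p))\<^sup>2 - 2 * (g \<bullet> (x - p)) + \<eta>x * (norm g)\<^sup>2"
    using implicit_step_bound[OF x', of p] \<open>0 < \<alpha>\<close> \<open>0 < \<eta>x\<close> params by simp
  have bound_y: "(1 + \<alpha>) * (inverse \<eta>y * (norm (y' - q))\<^sup>2)
    \<le> inverse \<eta>y * (norm (y - q))\<^sup>2 + \<mu>y * (norm (yb' - q))\<^sup>2 - 2 * (h \<bullet> (y - q)) + \<eta>y * (norm h)\<^sup>2"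
    using implicit_step_bound[OF y', of q] \<open>0 < \<alpha>\<close> \<open>0 < \<eta>y\<close> params by simp

  \<comment> \<open>Both points share the block \<open>yb'\<close>, so only smoothness in
    \<open>x\<close> enters. The factor 2 / \<alpha> makes the descent exactly the gradient term of
    \<open>bound_x\<close>.\<close>
  have "xb' - xu = - (\<eta>x * \<alpha>) *\<^sub>R g"
    using xb' by simp
  then have "f (xb', yb') \<le> f (xu, yb') - \<eta>x * \<alpha> * (norm g)\<^sup>2 + Lx / 2 * (\<eta>x * \<alpha>)\<^sup>2 * (norm g)\<^sup>2"
    using smooth[unfolded block_smooth_def, rule_format, of xb' yb' xu yb']
    by (simp add: g_def[symmetric] power2_norm_eq_inner[symmetric] power_mult_distrib)
  also have "Lx / 2 * (\<eta>x * \<alpha>)\<^sup>2 = (\<eta>x * \<alpha> * Lx) * (\<eta>x * \<alpha> / 2)"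
    by (simp add: power2_eq_square)
  also have "\<dots> = \<eta>x * \<alpha> / 2"
    by (simp only: params mult_1)
  finally have "f (xb', yb') \<le> f (xu, yb') - \<eta>x * \<alpha> / 2 * (norm g)\<^sup>2"
    by (simp add: mult_ac)
  then have "2 / \<alpha> * f (xb', yb') \<le> 2 / \<alpha> * (f (xu, yb') - \<eta>x * \<alpha> / 2 * (norm g)\<^sup>2)"
    using \<open>0 < \<alpha>\<close> by (intro mult_left_mono) auto
  then have descent: "2 / \<alpha> * f (xb', yb') \<le> 2 / \<alpha> * f (xu, yb') - \<eta>x * (norm g)\<^sup>2"
    using \<open>0 < \<alpha>\<close> by (simp add: right_diff_distrib)

  \<comment> \<open>Squaring the criterion cancels the squared length of
    \<open>c *\<^sub>R (yb' - yu)\<close>; multiplying by \<open>\<eta>y\<close> then turns 2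
    \<open>c\<close> into 2 / \<alpha>.\<close>
  define c where "c = inverse (\<eta>y * \<alpha>)"
  have "c > 0"
    using \<open>0 < \<alpha>\<close> \<open>0 < \<eta>y\<close> by (simp add: c_def)
  have "(norm (h + c *\<^sub>R (yb' - yu)))\<^sup>2 \<le> (c * norm (yb' - yu))\<^sup>2"
    using inexact unfolding c_def by (intro power_mono) auto
  moreover have "(norm (h + c *\<^sub>R (yb' - yu)))\<^sup>2
      = (norm h)\<^sup>2 + 2 * c * (h \<bullet> (yb' - yu)) + (c * norm (yb' - yu))\<^sup>2"
    unfolding power_mult_distrib power2_norm_eq_inner
    by (simp add: inner_add_left inner_add_right inner_commute power2_eq_square)
  ultimately have "(norm h)\<^sup>2 + 2 * c * (h \<bullet> (yb' - yu)) \<le> 0"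
    by simp
  then have "\<eta>y * ((norm h)\<^sup>2 + 2 * c * (h \<bullet> (yb' - yu))) \<le> 0"
    using \<open>0 < \<eta>y\<close> by (simp add: mult_le_0_iff)
  moreover have "\<eta>y * ((norm h)\<^sup>2 + 2 * c * (h \<bullet> (yb' - yu)))
      = \<eta>y * (norm h)\<^sup>2 + 2 / \<alpha> * (h \<bullet> (yb' - yu))"
    using \<open>0 < \<eta>y\<close> by (simp add: c_def field_simps)
  ultimately have inexact': "2 / \<alpha> * (h \<bullet> (yb' - yu)) \<le> - \<eta>y * (norm h)\<^sup>2"
    by simp

  \<comment> \<open>The quadratic terms are those of \<open>bound_x\<close> and
    \<open>bound_y\<close>, and cancel in the final sum.\<close>
  have opt: "2 * f (p, q) \<ge> 2 * f (xu, yb') + 2 * (g \<bullet> (p - xu)) + 2 * (h \<bullet> (q - yb'))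
      + \<mu>x * (norm (xu - p))\<^sup>2 + \<mu>y * (norm (yb' - q))\<^sup>2"
    using convex[unfolded block_strongly_convex_def, rule_format, of xu yb' p q]
    by (simp add: g_def h_def norm_minus_commute)
  have "f (xb, yb) \<ge> f (xu, yb') + g \<bullet> (xb - xu) + h \<bullet> (yb - yb')
      + \<mu>x / 2 * (norm (xb - xu))\<^sup>2 + \<mu>y / 2 * (norm (yb - yb'))\<^sup>2"
    using convex[unfolded block_strongly_convex_def, rule_format, of xu yb' xb yb]
    by (simp add: g_def h_def)
  moreover have "\<mu>x / 2 * (norm (xb - xu))\<^sup>2 \<ge> 0" "\<mu>y / 2 * (norm (yb - yb'))\<^sup>2 \<ge> 0"
    using \<mu> by simp_all
  ultimately have "g \<bullet> (xb - xu) + h \<bullet> (yb - yb') \<le> f (xb, yb) - f (xu, yb')"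
    by linarith
  then have old: "2 * (1 - \<alpha>) / \<alpha> * (g \<bullet> (xb - xu) + h \<bullet> (yb - yb'))
      \<le> 2 * (1 - \<alpha>) / \<alpha> * (f (xb, yb) - f (xu, yb'))"
    using \<open>0 < \<alpha>\<close> \<open>\<alpha> < 1\<close> by (intro mult_left_mono) auto

  \<comment> \<open>As \<open>xu\<close> is a convex combination of \<open>x\<close> and
    \<open>xb\<close>, the directions \<open>x - xu\<close> and \<open>xb - xu\<close> are opposite;
    this produces the weight used in \<open>old\<close>.\<close>
  have "\<alpha> * (g \<bullet> (x - xu)) = - (1 - \<alpha>) * (g \<bullet> (xb - xu))"
    by (simp add: xu_def inner_diff_right inner_add_right algebra_simps)
  then have "- 2 * (g \<bullet> (x - xu)) = 2 * (1 - \<alpha>) / \<alpha> * (g \<bullet> (xb - xu))"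
    using \<open>0 < \<alpha>\<close> by (simp add: field_simps)
  moreover have "- 2 * (g \<bullet> (x - p)) = 2 * (g \<bullet> (p - xu)) + (- 2 * (g \<bullet> (x - xu)))"
    by (simp add: inner_diff_right)
  ultimately have gx: "- 2 * (g \<bullet> (x - p))
      = 2 * (g \<bullet> (p - xu)) + 2 * (1 - \<alpha>) / \<alpha> * (g \<bullet> (xb - xu))"
    by (simp only:)
  \<comment> \<open>Here the gradient is taken at \<open>yb'\<close> instead of \<open>yu\<close>;
    the resulting extra term is the one bounded in \<open>inexact'\<close>.\<close>
  have "\<alpha> * (h \<bullet> (y - yb')) = - (1 - \<alpha>) * (h \<bullet> (yb - yb')) - h \<bullet> (yb' - yu)"
    by (simp add: yu_def inner_diff_right inner_add_right algebra_simps)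
  then have "- 2 * (h \<bullet> (y - yb'))
      = 2 * (1 - \<alpha>) / \<alpha> * (h \<bullet> (yb - yb')) + 2 / \<alpha> * (h \<bullet> (yb' - yu))"
    using \<open>0 < \<alpha>\<close> by (simp add: field_simps)
  moreover have "- 2 * (h \<bullet> (y - q)) = 2 * (h \<bullet> (q - yb')) + (- 2 * (h \<bullet> (y - yb')))"
    by (simp add: inner_diff_right)
  ultimately have hy: "- 2 * (h \<bullet> (y - q))
      = 2 * (h \<bullet> (q - yb')) + 2 * (1 - \<alpha>) / \<alpha> * (h \<bullet> (yb - yb')) + 2 / \<alpha> * (h \<bullet> (yb' - yu))"
    by (simp only: add.assoc)

  have "(1 + \<alpha>) * (inverse \<eta>x * (norm (x' - p))\<^sup>2 + inverse \<eta>y * (norm (y' - q))\<^sup>2)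
      + 2 / \<alpha> * f (xb', yb')
    \<le> inverse \<eta>x * (norm (x - p))\<^sup>2 + inverse \<eta>y * (norm (y - q))\<^sup>2
      + 2 * f (p, q) - 2 * f (xu, yb')
      + 2 * (1 - \<alpha>) / \<alpha> * (f (xb, yb) - f (xu, yb')) + 2 / \<alpha> * f (xu, yb')"
    using bound_x bound_y descent inexact' opt old gx hy
    by (simp only: distrib_left)
  \<comment> \<open>The coefficients of \<open>f (xu, yb')\<close> add up to -2 - 2 (1 - \<alpha>) /
    \<alpha> + 2 / \<alpha> = 0.\<close>
  moreover have "2 * f (p, q) - 2 * f (xu, yb')
      + 2 * (1 - \<alpha>) / \<alpha> * (f (xb, yb) - f (xu, yb')) + 2 / \<alpha> * f (xu, yb') - 2 / \<alpha> * f (p, q)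
    = (1 - \<alpha>) * (2 / \<alpha> * (f (xb, yb) - f (p, q)))"
    using \<open>0 < \<alpha>\<close> by (simp add: field_simps)
  ultimately show ?thesis
    unfolding right_diff_distrib[of "2 / \<alpha>" "f (xb', yb')"] by linarith
qed

theorem theorem2p2:
  fixes f :: "(real ^ 'm) \<times> (real ^ 'n) \<Rightarrow> real"
    and Lx Ly \<mu>x \<mu>y \<alpha> \<eta>x \<eta>y :: real
    and xs :: "real ^ 'm" and ys :: "real ^ 'n"
    and x xb :: "nat \<Rightarrow> real ^ 'm" and y yb :: "nat \<Rightarrow> real ^ 'n"
    and \<Psi> :: "nat \<Rightarrow> real"
  assumes "\<And>p. f differentiable (at p)"
    and "convex_on UNIV f"
    and "Lx > 0" "Ly > 0" "\<mu>x > 0" "\<mu>y > 0"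
    and "block_smooth Lx Ly f"
    and "block_strongly_convex \<mu>x \<mu>y f"
    and "\<And>p. f (xs, ys) \<le> f p"
    and "\<alpha> = sqrt (\<mu>x / Lx)"
    and "\<eta>x = 1 / sqrt (\<mu>x * Lx)"
    and "\<eta>y = 1 / \<mu>y * sqrt (\<mu>x / Lx)"
    and "0 < \<alpha>" "\<alpha> < 1"
    and "bam_iterates f \<eta>x \<eta>y \<alpha> x y xb yb"
    and "\<And>k. \<Psi> k = (1 + \<alpha>) * (inverse \<eta>x * (norm (x k - xs))\<^sup>2 + inverse \<eta>y * (norm (y k - ys))\<^sup>2)
                     + 2 / \<alpha> * (f (xb k, yb k) - f (xs, ys))"
  shows "\<forall>k. \<Psi> (Suc k) \<le> inverse (1 + \<alpha>) * \<Psi> k"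
proof
  fix k
  \<comment> \<open>\<open>D\<close> omits the factor 1 + \<alpha>: the one-step bound turns
    \<open>(1 + \<alpha>) * D (Suc k)\<close> into \<open>D k\<close>, which is already the required
    contraction.\<close>
  define D where "D j = inverse \<eta>x * (norm (x j - xs))\<^sup>2 + inverse \<eta>y * (norm (y j - ys))\<^sup>2" for j
  define G where "G j = 2 / \<alpha> * (f (xb j, yb j) - f (xs, ys))" for j
  have \<Psi>: "\<Psi> j = (1 + \<alpha>) * D j + G j" for j
    using assms(16) by (simp add: D_def G_def)
  have "\<eta>x > 0" "\<eta>y > 0"
    using assms(3,5,6,11,12) by simp_all
  moreover have "\<eta>x * \<alpha> * Lx = 1" "\<alpha> / \<eta>x = \<mu>x"
    using assms(3,5) by (simp_all add: assms(10,11) real_sqrt_divide real_sqrt_mult)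
  moreover have "\<alpha> / \<eta>y = \<mu>y"
    using assms(13) by (simp add: assms(12) assms(10)[symmetric])
  moreover have "bam_step f \<eta>x \<eta>y \<alpha> (x k) (y k) (xb k) (yb k)
      (x (Suc k)) (y (Suc k)) (xb (Suc k)) (yb (Suc k))"
    using assms(15) by (simp add: bam_iterates_def)
  ultimately have "\<Psi> (Suc k) \<le> D k + (1 - \<alpha>) * G k"
    using bam_step_contraction[OF assms(7,8)] assms(13,14) unfolding \<Psi> D_def G_def by blast
  also have "\<dots> \<le> D k + inverse (1 + \<alpha>) * G k"
  proof -
    \<comment> \<open>This is 1 - \<alpha> * \<alpha> \<le> 1. Minimality of \<open>(xs, ys)\<close>
      enters through the sign of \<open>G k\<close>.\<close>
    have "1 - \<alpha> \<le> inverse (1 + \<alpha>)"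
      using \<open>0 < \<alpha>\<close> by (simp add: field_simps)
    moreover have "G k \<ge> 0"
      using assms(9,13) by (simp add: G_def)
    ultimately show ?thesis
      by (simp add: mult_right_mono)
  qed
  also have "\<dots> = inverse (1 + \<alpha>) * \<Psi> k"
    using \<open>0 < \<alpha>\<close> by (simp add: \<Psi> field_simps)
  finally show "\<Psi> (Suc k) \<le> inverse (1 + \<alpha>) * \<Psi> k" .
qed

end
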